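(* Let $\gamma$ be the Tribonacci constant and let $x,y\in\mathbb Z_{-\gamma}$. Then $\mathrm{fr}(x+y)\le 6$ and $\mathrm{fr}(x-y)\le 6$; in particular $\mathrm{fr}(-x)\le 6$. In words: the sum and the difference of two $(-\gamma)$-integers have finite $(-\gamma)$-expansions with at most $6$ digits after the radix point.
   Context: Let $\gamma\approx 1.839$ be the unique real root of $x^3-x^2-x-1$ (the Tribonacci constant). Fix a real number $\beta>1$ and set $\ell=\frac{-\beta}{\beta+1}$. Define $T_{-\beta}:[\ell,\ell+1)\to[\ell,\ell+1)$ by $T_{-\beta}(x)=-\beta x-\lfloor -\beta x-\ell\rfloor$. For $x\in[\ell,\ell+1)$, the $(-\beta)$-expansion of $x$ is the digit sequence $d_{-\beta}(x)=x_1x_2x_3\cdots$ with $x_i=\lfloor -\beta\, T_{-\beta}^{i-1}(x)-\ell\rfloor\in\{0,1,\dots,\lfloor\beta\rfloor\}$. It satisfies $x=\sum_{i\ge1}x_i(-\beta)^{-i}$. For arbitrary $x\in\mathbb R$, let $k\ge 0$ be the minimal integer with $x/(-\beta)^k\in(\ell,\ell+1)$ and let $d_{-\beta}(x/(-\beta)^k)=x_1x_2\cdots$. The $(-\beta)$-expansion of $x$ is $x_1\cdots x_k\bullet x_{k+1}x_{k+2}\cdots$ if $k\ge1$, and $0\bullet x_1x_2\cdots$ if $k=0$. The digits written after the symbol $\bullet$ are the fractional digits. The set of $(-\beta)$-integers $\mathbb Z_{-\beta}$ is the set of $x\in\mathbb R$ whose $(-\beta)$-expansion has only zeros after $\bullet$.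 Equivalently, $\mathbb Z_{-\beta}=\bigcup_{i\ge0}(-\beta)^iT_{-\beta}^{-i}(0)$. The set of numbers with finite expansion is $\mathrm{Fin}(-\beta)=\bigcup_{i\ge0}(-\beta)^{-i}\mathbb Z_{-\beta}$. For $x\in\mathrm{Fin}(-\beta)$ with expansion $x_k\cdots x_0\bullet x_{-1}\cdots x_{-n}0^\omega$ and $x_{-n}\ne0$, set $\mathrm{fr}(x)=n$. Set $\mathrm{fr}(x)=0$ if all fractional digits are zero, and $\mathrm{fr}(x)=+\infty$ if $x\notin\mathrm{Fin}(-\beta)$. *)

theory Defs
  imports Complex_Main "HOL-Library.Extended_Nat"
begin

definition tribonacci :: real where
  "tribonacci = (THE x::real. x^3 - x^2 - x - 1 = 0)"

text \<open>Left end of the domain of the (-beta)-transformation.\<close>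
definition nb_ell :: "real \<Rightarrow> real" where
  "nb_ell \<beta> = - \<beta> / (\<beta> + 1)"

text \<open>The (-beta)-transformation on [ell, ell+1).\<close>
definition nb_T :: "real \<Rightarrow> real \<Rightarrow> real" where
  "nb_T \<beta> x = - \<beta> * x - of_int \<lfloor>- \<beta> * x - nb_ell \<beta>\<rfloor>"

text \<open>Digit sequence d_{-beta}(x) = x_1 x_2 ...; here indexed from 0, i.e.
  nb_digits b x i = x_(i+1) = floor(-b T^i(x) - ell).\<close>
definition nb_digits :: "real \<Rightarrow> real \<Rightarrow> nat \<Rightarrow> int" where
  "nb_digits \<beta> x i = \<lfloor>- \<beta> * ((nb_T \<beta> ^^ i) x) - nb_ell \<beta>\<rfloor>"

definition nb_k :: "real \<Rightarrow> real \<Rightarrow> nat" where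
  "nb_k \<beta> x = (LEAST k. x / (- \<beta>) ^ k \<in> {nb_ell \<beta> <..< nb_ell \<beta> + 1})"

text \<open>Fractional digits of the (-beta)-expansion of an arbitrary real x:
  nb_frac b x j is the (j+1)-th digit after the radix point, i.e. x_(k+j+1).\<close>
definition nb_frac :: "real \<Rightarrow> real \<Rightarrow> nat \<Rightarrow> int" where
  "nb_frac \<beta> x j = nb_digits \<beta> (x / (- \<beta>) ^ nb_k \<beta> x) (nb_k \<beta> x + j)"

definition nb_integers :: "real \<Rightarrow> real set" where
  "nb_integers \<beta> = {x. \<forall>j. nb_frac \<beta> x j = 0}"

definition nb_fr :: "real \<Rightarrow> real \<Rightarrow> enat" where
  "nb_fr \<beta> x =
     (if \<exists>n. \<forall>j\<ge>n. nb_frac \<beta> x j = 0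
      then enat (LEAST n. \<forall>j\<ge>n. nb_frac \<beta> x j = 0)
      else \<infinity>)"

end

theory Submission
  imports Defs
begin

text \<open>
  Scale \<open>x\<close>, \<open>y\<close> and \<open>x + y\<close> by a common power of \<open>-\<gamma>\<close> to \<open>u\<close>, \<open>v\<close>, \<open>w = u + v\<close> in the
  domain of \<open>T\<close>. The defect \<open>T^n w - T^n u - T^n v\<close> starts at \<open>0\<close>, evolves by
  \<open>s \<mapsto> -\<gamma> s + e\<close> with \<open>e \<in> {-1, 0, 1, 2}\<close>, and stays in a bounded real interval. Since the
  conjugates of \<open>\<gamma>\<close> lie inside the unit disc, only finitely many elements of \<open>\<int>[\<gamma>]\<close> (in fact
  30) can occur. When the integer parts of \<open>x\<close> and \<open>y\<close> are used up, the defect is the fractional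
  part of \<open>x + y\<close>, and each candidate in the domain of \<open>T\<close> is sent to \<open>0\<close> by \<open>T^6\<close>.
  For \<open>x - y\<close> the same automaton is applied to \<open>x = y + (x - y)\<close>; the defect then ends in minus
  the fractional part.
\<close>

section \<open>The transformation for a general base\<close>

lemma nb_T_range: "nb_T \<beta> z \<in> {nb_ell \<beta> ..< nb_ell \<beta> + 1}"
  unfolding nb_T_def by (simp, linarith)

lemma nb_T_funpow_range:
  assumes "z \<in> {nb_ell \<beta> ..< nb_ell \<beta> + 1}"
  shows "(nb_T \<beta> ^^ n) z \<in> {nb_ell \<beta> ..< nb_ell \<beta> + 1}"
  using assms nb_T_range by (cases n) auto

lemma nb_T_funpow_Suc:
  "(nb_T \<beta> ^^ Suc n) z = - \<beta> * (nb_T \<beta> ^^ n) z - of_int (nb_digits \<beta> z n)"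
  by (simp add: nb_digits_def nb_T_def)

text \<open>The target interval is half open of length 1, so only one integer can move the image
  into it, namely the floor.\<close>

lemma nb_T_eqI:
  assumes "- \<beta> * z - of_int d \<in> {nb_ell \<beta> ..< nb_ell \<beta> + 1}"
  shows "nb_T \<beta> z = - \<beta> * z - of_int d"
proof -
  have "\<lfloor>- \<beta> * z - nb_ell \<beta>\<rfloor> = d"
    using assms by (intro floor_unique) auto
  then show ?thesis by (simp add: nb_T_def)
qed

context
  fixes \<beta> :: real
  assumes base_gt_1: "\<beta> > 1"
begin

lemma nb_ell_bounds: "- 1 < nb_ell \<beta>" "nb_ell \<beta> < 0"
  using base_gt_1 by (auto simp: nb_ell_def field_simps)

lemma nb_T_zero: "nb_T \<beta> 0 = 0"
  using nb_T_eqI[of \<beta> 0 0] nb_ell_bounds by simp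

lemma nb_T_funpow_zero_mono:
  assumes "(nb_T \<beta> ^^ m) z = 0" and "m \<le> n"
  shows "(nb_T \<beta> ^^ n) z = 0"
proof -
  have "(nb_T \<beta> ^^ i) 0 = 0" for i by (induction i) (auto simp: nb_T_zero)
  then show ?thesis
    using assms by (metis comp_apply funpow_add le_add_diff_inverse2)
qed

lemma nb_digits_eq_0:
  assumes "(nb_T \<beta> ^^ n) z = 0"
  shows "nb_digits \<beta> z n = 0"
  using assms nb_ell_bounds by (simp add: nb_digits_def floor_eq_iff)

text \<open>The interval has to be open: \<open>nb_ell \<beta> / - \<beta>\<close> equals
  \<open>nb_ell \<beta> + 1\<close>, which lies outside the domain.\<close>

lemma divide_base_mem:
  assumes "z \<in> {nb_ell \<beta> <..< nb_ell \<beta> + 1}"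
  shows "z / - \<beta> \<in> {nb_ell \<beta> <..< nb_ell \<beta> + 1}"
proof -
  have *: "nb_ell \<beta> * (\<beta> + 1) = - \<beta>"
    using base_gt_1 by (simp add: nb_ell_def)
  have "nb_ell \<beta> * \<beta> < nb_ell \<beta>"
    using nb_ell_bounds base_gt_1 by (simp add: mult_less_cancel_left1)
  with * assms base_gt_1 show ?thesis
    by (auto simp: field_simps)
qed

lemma divide_base_power_mem:
  assumes "x / (- \<beta>) ^ k \<in> {nb_ell \<beta> <..< nb_ell \<beta> + 1}"
  shows "x / (- \<beta>) ^ (k + i) \<in> {nb_ell \<beta> <..< nb_ell \<beta> + 1}"
proof (induction i)
  case (Suc i)
  have "x / (- \<beta>) ^ (k + Suc i) = x / (- \<beta>) ^ (k + i) / - \<beta>"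
    by (simp add: mult.commute)
  then show ?case using divide_base_mem[OF Suc] by (simp only:)
qed (use assms in simp)

text \<open>The \<open>LEAST\<close> in \<open>nb_k\<close> has a witness because
  \<open>x / (- \<beta>) ^ k\<close> tends to 0, an interior point.\<close>

lemma divide_nb_k_mem: "x / (- \<beta>) ^ nb_k \<beta> x \<in> {nb_ell \<beta> <..< nb_ell \<beta> + 1}"
proof -
  have "(\<lambda>k. x * (inverse (- \<beta>)) ^ k) \<longlonglongrightarrow> x * 0"
    using base_gt_1
    by (intro tendsto_intros LIMSEQ_power_zero) (simp add: field_simps abs_if)
  moreover have "open {nb_ell \<beta> <..< nb_ell \<beta> + 1}" "x * 0 \<in> {nb_ell \<beta> <..< nb_ell \<beta> + 1}"
    using nb_ell_bounds by auto
  ultimately have "eventually (\<lambda>k. x * (inverse (- \<beta>)) ^ k \<in> {nb_ell \<beta> <..< nb_ell \<beta> + 1}) sequentially"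
    by (rule topological_tendstoD)
  then obtain k where "x * (inverse (- \<beta>)) ^ k \<in> {nb_ell \<beta> <..< nb_ell \<beta> + 1}"
    by (auto simp: eventually_sequentially)
  then have "x / (- \<beta>) ^ k \<in> {nb_ell \<beta> <..< nb_ell \<beta> + 1}"
    by (simp only: power_inverse divide_inverse)
  then show ?thesis unfolding nb_k_def by (rule LeastI)
qed

text \<open>Each extra division by \<open>- \<beta>\<close> prepends a digit 0, which one
  application of \<open>nb_T\<close> strips.\<close>

lemma nb_T_funpow_divide:
  assumes "x / (- \<beta>) ^ k \<in> {nb_ell \<beta> <..< nb_ell \<beta> + 1}"
  shows "(nb_T \<beta> ^^ i) (x / (- \<beta>) ^ (k + i)) = x / (- \<beta>) ^ k"
proof (induction i)
  case (Suc i)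
  have "- \<beta> * (x / (- \<beta>) ^ (k + Suc i)) = x / (- \<beta>) ^ (k + i)"
    using base_gt_1 by (simp add: field_simps)
  then have "nb_T \<beta> (x / (- \<beta>) ^ (k + Suc i)) = x / (- \<beta>) ^ (k + i)"
    using nb_T_eqI[of \<beta> "x / (- \<beta>) ^ (k + Suc i)" 0] divide_base_power_mem[OF assms, of i]
    by auto
  then show ?case using Suc by (simp only: funpow_Suc_right comp_apply)
qed simp

text \<open>The part after the radix point is independent of the scale, so several numbers can share
  one exponent \<open>K\<close>.\<close>

lemma nb_T_funpow_nb_k:
  assumes "nb_k \<beta> x \<le> K"
  shows "(nb_T \<beta> ^^ (K + j)) (x / (- \<beta>) ^ K)
    = (nb_T \<beta> ^^ (nb_k \<beta> x + j)) (x / (- \<beta>) ^ nb_k \<beta> x)"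
proof -
  obtain i where K: "K = nb_k \<beta> x + i" using assms le_Suc_ex by blast
  have "(nb_T \<beta> ^^ (K + j)) (x / (- \<beta>) ^ K)
      = (nb_T \<beta> ^^ (nb_k \<beta> x + j)) ((nb_T \<beta> ^^ i) (x / (- \<beta>) ^ (nb_k \<beta> x + i)))"
    unfolding K by (metis (no_types, lifting) add.assoc add.commute comp_apply funpow_add)
  then show ?thesis by (simp only: nb_T_funpow_divide[OF divide_nb_k_mem])
qed

text \<open>Along zero digits \<open>nb_T\<close> multiplies by \<open>- \<beta>\<close>, so a
  nonzero iterate would outgrow the bounded domain.\<close>

lemma nb_T_eq_0_if_digits_eq_0:
  assumes z: "z \<in> {nb_ell \<beta> ..< nb_ell \<beta> + 1}" and digits: "\<And>j. nb_digits \<beta> z (n + j) = 0"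
  shows "(nb_T \<beta> ^^ n) z = 0"
proof (rule ccontr)
  let ?t = "(nb_T \<beta> ^^ n) z"
  assume nz: "?t \<noteq> 0"
  have pow: "(nb_T \<beta> ^^ (n + j)) z = (- \<beta>) ^ j * ?t" for j
  proof (induction j)
    case (Suc j)
    then show ?case using nb_T_funpow_Suc[of "n + j" \<beta> z] digits[of j] by simp
  qed simp
  have bounded: "\<beta> ^ j * \<bar>?t\<bar> \<le> 1" for j
  proof -
    have "\<bar>(nb_T \<beta> ^^ (n + j)) z\<bar> \<le> 1"
      using nb_T_funpow_range[OF z, of "n + j"] nb_ell_bounds by auto
    then show ?thesis using base_gt_1 by (simp add: pow abs_mult power_abs)
  qed
  obtain j where "1 / \<bar>?t\<bar> < \<beta> ^ j"
    using real_arch_pow[OF base_gt_1] by blast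
  then show False using bounded[of j] nz by (simp add: field_simps)
qed

lemma nb_integers_nb_T_eq_0:
  assumes "x \<in> nb_integers \<beta>" and "nb_k \<beta> x \<le> K"
  shows "(nb_T \<beta> ^^ K) (x / (- \<beta>) ^ K) = 0"
proof -
  have "(nb_T \<beta> ^^ nb_k \<beta> x) (x / (- \<beta>) ^ nb_k \<beta> x) = 0"
    using assms(1) divide_nb_k_mem[of x]
    by (intro nb_T_eq_0_if_digits_eq_0) (auto simp: nb_integers_def nb_frac_def)
  then show ?thesis using nb_T_funpow_nb_k[OF assms(2), of 0] by simp
qed

lemma nb_fr_leI:
  assumes "(nb_T \<beta> ^^ (K + n)) (x / (- \<beta>) ^ K) = 0" and "nb_k \<beta> x \<le> K"
  shows "nb_fr \<beta> x \<le> enat n"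
proof -
  have "(nb_T \<beta> ^^ (nb_k \<beta> x + n)) (x / (- \<beta>) ^ nb_k \<beta> x) = 0"
    using assms(1) nb_T_funpow_nb_k[OF assms(2), of n] by argo
  then have *: "\<forall>j\<ge>n. nb_frac \<beta> x j = 0"
    unfolding nb_frac_def by (auto intro!: nb_digits_eq_0 elim: nb_T_funpow_zero_mono)
  then have "(LEAST n. \<forall>j\<ge>n. nb_frac \<beta> x j = 0) \<le> n" by (rule Least_le)
  then show ?thesis using * by (auto simp: nb_fr_def)
qed

lemma nb_digits_range:
  assumes z: "z \<in> {nb_ell \<beta> ..< nb_ell \<beta> + 1}"
  shows "0 \<le> nb_digits \<beta> z n" and "nb_digits \<beta> z n \<le> \<lfloor>\<beta>\<rfloor>"
proof -
  let ?t = "(nb_T \<beta> ^^ n) z"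
  \<comment> \<open>By this identity \<open>- \<beta> * t - nb_ell \<beta>\<close> falls from
    \<open>\<beta>\<close> to 0 as \<open>t\<close> runs through the domain.\<close>
  have *: "nb_ell \<beta> * \<beta> = - \<beta> - nb_ell \<beta>"
    using base_gt_1 by (simp add: nb_ell_def field_simps)
  have "nb_ell \<beta> * \<beta> \<le> ?t * \<beta>" "?t * \<beta> \<le> (nb_ell \<beta> + 1) * \<beta>"
    using nb_T_funpow_range[OF z, of n] base_gt_1 by (auto intro!: mult_right_mono)
  then have "0 \<le> - \<beta> * ?t - nb_ell \<beta>" "- \<beta> * ?t - nb_ell \<beta> \<le> \<beta>"
    using * by (auto simp: algebra_simps)
  then show "0 \<le> nb_digits \<beta> z n" "nb_digits \<beta> z n \<le> \<lfloor>\<beta>\<rfloor>"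
    unfolding nb_digits_def by (auto intro!: floor_mono)
qed

end

section \<open>The Tribonacci constant\<close>

text \<open>Justifies the \<open>THE\<close> in \<open>tribonacci\<close>. All real roots exceed 1,
  and for such \<open>x\<close>, \<open>y\<close> the cofactor of \<open>x - y\<close> in the
  difference of the two equations is positive.\<close>

lemma tribonacci_root_unique:
  fixes x y :: real
  assumes "x^3 - x^2 - x - 1 = 0" and "y^3 - y^2 - y - 1 = 0"
  shows "x = y"
proof -
  have gt1: "z > 1" if z: "z^3 - z^2 - z - 1 = 0" for z :: real
  proof (rule ccontr)
    assume "\<not> z > 1"
    moreover have "z^2 * (z - 1) = z + 1"
      using z by (simp add: algebra_simps power2_eq_square power3_eq_cube)
    moreover have "z^2 * (z - 1) \<le> 0" using \<open>\<not> z > 1\<close> by (simp add: mult_nonneg_nonpos)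
    ultimately have "z \<le> -1" by simp
    moreover from this have "1 \<le> z^2"
      using abs_le_square_iff[of 1 z] by simp
    ultimately have "z * (z^2 - 1) \<le> 0"
      by (intro mult_nonpos_nonneg) auto
    moreover have "z * (z^2 - 1) = z^2 + 1"
      using z by (simp add: algebra_simps power2_eq_square power3_eq_cube)
    ultimately show False using zero_le_power2[of z] by linarith
  qed
  have "(x - y) * (x * (x - 1) + y * (y - 1) + (x * y - 1)) = 0"
    using assms by (simp add: algebra_simps power2_eq_square power3_eq_cube)
  moreover have "x * (x - 1) > 0" "y * (y - 1) > 0" "x * y > 1"
    using gt1[OF assms(1)] gt1[OF assms(2)] less_1_mult by auto
  ultimately show ?thesis by simp
qed

lemma tribonacci_root: "tribonacci ^ 3 = tribonacci ^ 2 + tribonacci + 1"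
  and tribonacci_bounds: "1839 / 1000 < tribonacci" "tribonacci < 1840 / 1000"
proof -
  let ?p = "\<lambda>x::real. x^3 - x^2 - x - 1"
  have "\<exists>x\<ge>1839/1000. x \<le> 1840/1000 \<and> ?p x = 0"
    by (intro IVT' continuous_intros) (auto simp: power2_eq_square power3_eq_cube)
  then obtain x where x: "x \<ge> 1839/1000" "x \<le> 1840/1000" "?p x = 0" by blast
  have "tribonacci = x"
    unfolding tribonacci_def using x(3) tribonacci_root_unique by blast
  moreover have "?p (1839/1000) \<noteq> 0" "?p (1840/1000) \<noteq> 0"
    by (simp_all add: power2_eq_square power3_eq_cube)
  then have "x \<noteq> 1839/1000" "x \<noteq> 1840/1000"
    using x(3) by blast+
  ultimately show "tribonacci ^ 3 = tribonacci ^ 2 + tribonacci + 1"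
    "1839 / 1000 < tribonacci" "tribonacci < 1840 / 1000" using x by auto
qed

lemma tribonacci_sq_bounds: "338 / 100 < tribonacci ^ 2" "tribonacci ^ 2 < 339 / 100"
proof -
  define g where "g = tribonacci"
  have g: "1839 / 1000 < g" "g < 1840 / 1000" "g * g^2 = g^2 + g + 1"
    using tribonacci_bounds tribonacci_root
    by (auto simp: g_def power2_eq_square power3_eq_cube)
  \<comment> \<open>The cubic turns both bounds on \<open>g^2\<close> into linear inequalities in
    \<open>g\<close>.\<close>
  have eq: "g^2 * (g - 1) = g + 1" using g(3) by (simp add: algebra_simps)
  have "338 / 100 * (g - 1) < g^2 * (g - 1)" "g^2 * (g - 1) < 339 / 100 * (g - 1)"
    unfolding eq using g(1,2) by auto
  then show "338 / 100 < tribonacci ^ 2" "tribonacci ^ 2 < 339 / 100"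
    using g(1) unfolding g_def by (simp_all only: mult_less_cancel_right)
qed

lemma nb_ell_tribonacci_bounds:
  "- 65 / 100 < nb_ell tribonacci" "nb_ell tribonacci < - 64 / 100"
  using tribonacci_bounds by (auto simp: nb_ell_def field_simps)

section \<open>The finite automaton\<close>

type_synonym ztrib = "int \<times> int \<times> int"

text \<open>Integer coordinates for elements of the ring generated by \<open>tribonacci\<close>, so
  that the finite checks below can be evaluated.\<close>

definition ztrib_val :: "ztrib \<Rightarrow> real" where
  "ztrib_val = (\<lambda>(a, b, c). of_int a + of_int b * tribonacci + of_int c * tribonacci ^ 2)"

text \<open>Since \<open>\<gamma>^3 = \<gamma>^2 + \<gamma> + 1\<close>, this is \<open>s \<mapsto> -\<gamma> s + e\<close> on values.\<close>
definition ztrib_step :: "int \<Rightarrow> ztrib \<Rightarrow> ztrib" where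
  "ztrib_step e = (\<lambda>(a, b, c). (e - c, - (a + c), - (b + c)))"

definition ztrib_neg :: "ztrib \<Rightarrow> ztrib" where
  "ztrib_neg = (\<lambda>(a, b, c). (- a, - b, - c))"

text \<open>Bounds for \<open>100 * ztrib_val s\<close>, from \<open>1.83 < \<gamma> < 1.84\<close> and \<open>3.38 < \<gamma>^2 < 3.39\<close>.\<close>
definition ztrib_lb :: "ztrib \<Rightarrow> int" where
  "ztrib_lb = (\<lambda>(a, b, c). 100 * a + (if 0 \<le> b then 183 else 184) * b + (if 0 \<le> c then 338 else 339) * c)"

definition ztrib_ub :: "ztrib \<Rightarrow> int" where
  "ztrib_ub = (\<lambda>(a, b, c). 100 * a + (if 0 \<le> b then 184 else 183) * b + (if 0 \<le> c then 339 else 338) * c)"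

lemma ztrib_val_step: "ztrib_val (ztrib_step e s) = - tribonacci * ztrib_val s + of_int e"
proof -
  obtain a b c where s: "s = (a, b, c)" by (cases s)
  have "tribonacci * tribonacci ^ 2 = tribonacci ^ 2 + tribonacci + 1"
    using tribonacci_root by (simp add: power2_eq_square power3_eq_cube)
  then have "- tribonacci * ztrib_val s = - of_int c - of_int (a + c) * tribonacci
    - of_int (b + c) * tribonacci ^ 2"
    unfolding s ztrib_val_def by (simp, algebra)
  then show ?thesis by (simp add: s ztrib_val_def ztrib_step_def algebra_simps)
qed

lemma ztrib_val_neg: "ztrib_val (ztrib_neg s) = - ztrib_val s"
  by (cases s) (simp add: ztrib_val_def ztrib_neg_def)

lemma ztrib_val_bounds:
  "of_int (ztrib_lb s) \<le> 100 * ztrib_val s" "100 * ztrib_val s \<le> of_int (ztrib_ub s)"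
proof -
  \<comment> \<open>A negative coefficient \<open>k\<close> swaps the roles of the two ends
    \<open>p\<close> and \<open>q\<close>.\<close>
  have mult: "of_int ((if 0 \<le> k then p else q) * k) \<le> 100 * (of_int k * r) \<and>
      100 * (of_int k * r) \<le> of_int ((if 0 \<le> k then q else p) * k)"
    if r: "of_int p < 100 * r" "100 * r < of_int q" for k p q :: int and r :: real
  proof (cases "0 \<le> k")
    case True
    then show ?thesis
      using r mult_right_mono[of "of_int p" "100 * r" "of_int k"]
        mult_right_mono[of "100 * r" "of_int q" "of_int k"] by (simp add: mult_ac)
  next
    case False
    then show ?thesis
      using r mult_right_mono_neg[of "of_int p" "100 * r" "of_int k"]
        mult_right_mono_neg[of "100 * r" "of_int q" "of_int k"] by (simp add: mult_ac)
  qed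
  obtain a b c where s: "s = (a, b, c)" by (cases s)
  have "of_int ((if 0 \<le> b then 183 else 184) * b) \<le> 100 * (of_int b * tribonacci) \<and>
      100 * (of_int b * tribonacci) \<le> of_int ((if 0 \<le> b then 184 else 183) * b)"
    using tribonacci_bounds by (intro mult) auto
  moreover have "of_int ((if 0 \<le> c then 338 else 339) * c) \<le> 100 * (of_int c * tribonacci ^ 2) \<and>
      100 * (of_int c * tribonacci ^ 2) \<le> of_int ((if 0 \<le> c then 339 else 338) * c)"
    using tribonacci_sq_bounds by (intro mult) auto
  ultimately show "of_int (ztrib_lb s) \<le> 100 * ztrib_val s"
    "100 * ztrib_val s \<le> of_int (ztrib_ub s)"
    unfolding s ztrib_val_def ztrib_lb_def ztrib_ub_def prod.case of_int_add distrib_left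
    by simp_all
qed

text \<open>The states reachable from \<open>0\<close> without leaving the interval \<open>(-\<ell> - 2, 1 - \<ell>)\<close>.\<close>
definition defects :: "ztrib list" where
  "defects =
    [(-3, 0, 1), (-2, -3, 2), (-2, -2, 2), (-2, -1, 1), (-2, 0, 1), (-2, 1, 0),
     (-1, -3, 2), (-1, -2, 1), (-1, -1, 1), (-1, 0, 0), (-1, 1, 0), (-1, 2, -1),
     (0, -3, 2), (0, -2, 1), (0, -1, 1), (0, 0, 0), (0, 2, -1), (1, -3, 1),
     (1, -2, 1), (1, -1, 0), (1, 0, 0), (1, 1, -1), (1, 2, -1), (2, -3, 1),
     (2, -1, 0), (2, 1, -1), (3, -2, 0), (3, -1, 0), (3, 0, -1), (3, 1, -1)]"

text \<open>The list is closed under every step that may stay in the interval. The limits are its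
  ends times 100, rounded outwards using \<open>nb_ell_tribonacci_bounds\<close>.\<close>

lemma defects_step_check:
  "list_all (\<lambda>s. list_all (\<lambda>e. let t = ztrib_step e s in
      ztrib_ub t < - 136 \<or> 165 < ztrib_lb t \<or> List.member defects t) [-1, 0, 1, 2]) defects"
  by code_simp

lemma defects_step:
  assumes "s \<in> set defects" and "e \<in> {-1..2}"
    and "- nb_ell tribonacci - 2 \<le> ztrib_val (ztrib_step e s)"
    and "ztrib_val (ztrib_step e s) \<le> 1 - nb_ell tribonacci"
  shows "ztrib_step e s \<in> set defects"
proof -
  let ?t = "ztrib_step e s"
  have "e \<in> set [-1, 0, 1, 2]" using assms(2) by auto
  then have "ztrib_ub ?t < - 136 \<or> 165 < ztrib_lb ?t \<or> ?t \<in> set defects"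
    using defects_step_check assms(1) unfolding list_all_iff Let_def List.member_iff by blast
  moreover have "real_of_int (ztrib_ub ?t) > - 136" "real_of_int (ztrib_lb ?t) < 165"
    using assms(3,4) nb_ell_tribonacci_bounds ztrib_val_bounds[of ?t] by linarith+
  ultimately show ?thesis by simp
qed

text \<open>A digit for which the image provably lies in the domain of \<open>T\<close> is the correct one, so no
  floor has to be computed.\<close>
fun vanishes :: "nat \<Rightarrow> ztrib \<Rightarrow> bool" where
  "vanishes 0 s = (s = (0, 0, 0))"
| "vanishes (Suc n) s = list_ex (\<lambda>e. let t = ztrib_step e s in
     - 64 \<le> ztrib_lb t \<and> ztrib_ub t \<le> 35 \<and> vanishes n t) [0, -1]"

text \<open>The limits -64 and 35 in \<open>vanishes\<close> round the domain inwards, so passing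
  the test proves membership; \<open>e\<close> is minus the digit.\<close>

lemma vanishes_nb_T:
  assumes "vanishes n s"
  shows "(nb_T tribonacci ^^ n) (ztrib_val s) = 0"
  using assms
proof (induction n arbitrary: s)
  case 0
  then show ?case by (simp add: ztrib_val_def)
next
  case (Suc n)
  then obtain e where e: "- 64 \<le> ztrib_lb (ztrib_step e s)" "ztrib_ub (ztrib_step e s) \<le> 35"
    "vanishes n (ztrib_step e s)"
    by (auto simp: Let_def)
  have "- 64 \<le> 100 * ztrib_val (ztrib_step e s)" "100 * ztrib_val (ztrib_step e s) \<le> 35"
    using e(1,2) ztrib_val_bounds[of "ztrib_step e s"] by linarith+
  then have "ztrib_val (ztrib_step e s) \<in> {nb_ell tribonacci ..< nb_ell tribonacci + 1}"
    using nb_ell_tribonacci_bounds by auto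
  then have "nb_T tribonacci (ztrib_val s) = ztrib_val (ztrib_step e s)"
    using nb_T_eqI[of tribonacci "ztrib_val s" "- e"] by (simp add: ztrib_val_step)
  then show ?case using Suc.IH[OF e(3)] by (simp only: funpow_Suc_right comp_apply)
qed

text \<open>Here -65 and 36 round the domain outwards, so only values surely outside it are
  discarded. The negatives serve the difference \<open>x - y\<close>.\<close>

lemma defects_vanish_check:
  "list_all (\<lambda>s. list_all (\<lambda>t. ztrib_ub t < - 65 \<or> 36 < ztrib_lb t \<or> vanishes 6 t)
     [s, ztrib_neg s]) defects"
  by code_simp

lemma defects_vanish:
  assumes "s \<in> set defects" and "t = s \<or> t = ztrib_neg s"
    and "ztrib_val t \<in> {nb_ell tribonacci ..< nb_ell tribonacci + 1}"
  shows "(nb_T tribonacci ^^ 6) (ztrib_val t) = 0"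
proof -
  have "t \<in> set [s, ztrib_neg s]" using assms(2) by auto
  then have "ztrib_ub t < - 65 \<or> 36 < ztrib_lb t \<or> vanishes 6 t"
    using defects_vanish_check assms(1) unfolding list_all_iff by blast
  moreover have "real_of_int (ztrib_ub t) > - 65" "real_of_int (ztrib_lb t) < 36"
    using assms(3) nb_ell_tribonacci_bounds ztrib_val_bounds[of t] by auto
  ultimately show ?thesis using vanishes_nb_T by simp
qed

lemma defect_mem:
  assumes "u \<in> {nb_ell tribonacci ..< nb_ell tribonacci + 1}"
    and "v \<in> {nb_ell tribonacci ..< nb_ell tribonacci + 1}"
    and "u + v \<in> {nb_ell tribonacci ..< nb_ell tribonacci + 1}"
  shows "\<exists>s\<in>set defects. (nb_T tribonacci ^^ n) (u + v)
    = (nb_T tribonacci ^^ n) u + (nb_T tribonacci ^^ n) v + ztrib_val s"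
proof (induction n)
  case 0
  show ?case by (rule bexI[of _ "(0, 0, 0)"]) (auto simp: ztrib_val_def defects_def)
next
  case (Suc n)
  let ?T = "\<lambda>n. nb_T tribonacci ^^ n" and ?d = "\<lambda>z. nb_digits tribonacci z n"
  obtain s where s: "s \<in> set defects" "?T n (u + v) = ?T n u + ?T n v + ztrib_val s"
    using Suc by blast
  define e where "e = ?d u + ?d v - ?d (u + v)"
  have gt1: "tribonacci > 1" using tribonacci_bounds by simp
  \<comment> \<open>All digits are therefore 0 or 1, which confines \<open>e\<close> to -1, 0, 1,
    2.\<close>
  have "\<lfloor>tribonacci\<rfloor> = 1" using tribonacci_bounds by (simp add: floor_eq_iff)
  then have "e \<in> {-1..2}"
    using nb_digits_range[OF gt1 assms(1), of n] nb_digits_range[OF gt1 assms(2), of n]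
      nb_digits_range[OF gt1 assms(3), of n] by (auto simp: e_def)
  moreover have eq: "?T (Suc n) (u + v) = ?T (Suc n) u + ?T (Suc n) v + ztrib_val (ztrib_step e s)"
    unfolding nb_T_funpow_Suc ztrib_val_step s(2) e_def by (simp add: algebra_simps)
  \<comment> \<open>All three iterates lie in the domain; the ends are
    \<open>\<ell> - 2 * (\<ell> + 1)\<close> and \<open>(\<ell> + 1) - 2 * \<ell>\<close>, with
    \<open>\<ell>\<close> for \<open>nb_ell tribonacci\<close>.\<close>
  moreover have "- nb_ell tribonacci - 2 \<le> ztrib_val (ztrib_step e s)"
    "ztrib_val (ztrib_step e s) \<le> 1 - nb_ell tribonacci"
    using eq nb_T_funpow_range[OF assms(1), of "Suc n"] nb_T_funpow_range[OF assms(2), of "Suc n"]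
      nb_T_funpow_range[OF assms(3), of "Suc n"] unfolding atLeastLessThan_iff by linarith+
  ultimately show ?case using defects_step[OF s(1)] by blast
qed

lemma nb_fr_add_diff_le:
  assumes "x \<in> nb_integers tribonacci" and "y \<in> nb_integers tribonacci"
  shows "nb_fr tribonacci (x + y) \<le> 6" and "nb_fr tribonacci (x - y) \<le> 6"
proof -
  let ?k = "nb_k tribonacci" and ?I = "{nb_ell tribonacci ..< nb_ell tribonacci + 1}"
  have gt1: "tribonacci > 1" using tribonacci_bounds by simp
  define K where "K = max (max (?k x) (?k y)) (max (?k (x + y)) (?k (x - y)))"
  define f where "f z = z / (- tribonacci) ^ K" for z
  define T where "T = nb_T tribonacci ^^ K"
  have K: "?k x \<le> K" "?k y \<le> K" "?k (x + y) \<le> K" "?k (x - y) \<le> K"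
    by (auto simp: K_def)
  have mem: "f z \<in> ?I" if "?k z \<le> K" for z
    using divide_base_power_mem[OF gt1 divide_nb_k_mem[OF gt1], of z "K - ?k z"] that
    by (simp add: f_def)
  have T0: "T (f x) = 0" "T (f y) = 0"
    unfolding T_def f_def using K assms by (auto intro!: nb_integers_nb_T_eq_0 gt1)
  have fr: "nb_fr tribonacci z \<le> 6" if z: "?k z \<le> K"
    and s: "s \<in> set defects" "t = s \<or> t = ztrib_neg s" "T (f z) = ztrib_val t" for z s t
  proof -
    have "T (f z) \<in> ?I" unfolding T_def by (intro nb_T_funpow_range mem z)
    then have "(nb_T tribonacci ^^ 6) (T (f z)) = 0"
      using defects_vanish s by simp
    then have "(nb_T tribonacci ^^ (K + 6)) (z / (- tribonacci) ^ K) = 0"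
      by (metis T_def f_def add.commute comp_apply funpow_add)
    from nb_fr_leI[OF gt1 this z] show ?thesis by (simp add: numeral_eq_enat)
  qed
  have sum: "f (x + y) = f x + f y" "f x = f y + f (x - y)"
    by (simp_all add: f_def add_divide_distrib diff_divide_distrib)
  show "nb_fr tribonacci (x + y) \<le> 6"
  proof -
    obtain s where "s \<in> set defects" "T (f (x + y)) = ztrib_val s"
      using defect_mem[of "f x" "f y" K] mem K T0 by (auto simp: sum(1)[symmetric] T_def)
    then show ?thesis using fr K by blast
  qed
  show "nb_fr tribonacci (x - y) \<le> 6"
  proof -
    \<comment> \<open>The 0 on the left is \<open>T (f x)\<close>, and the summand
      \<open>T (f y)\<close> has vanished as well.\<close>
    obtain s where "s \<in> set defects" "0 = T (f (x - y)) + ztrib_val s"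
      using defect_mem[of "f y" "f (x - y)" K] mem K T0 by (auto simp: sum(2)[symmetric] T_def)
    moreover from this(2) have "T (f (x - y)) = ztrib_val (ztrib_neg s)"
      by (simp add: ztrib_val_neg)
    ultimately show ?thesis using fr K by blast
  qed
qed

theorem theorem1:
  fixes x y :: real
  assumes "x \<in> nb_integers tribonacci" and "y \<in> nb_integers tribonacci"
  shows "nb_fr tribonacci (x + y) \<le> 6 \<and> nb_fr tribonacci (x - y) \<le> 6
         \<and> nb_fr tribonacci (- x) \<le> 6"
proof -
  have gt1: "tribonacci > 1" using tribonacci_bounds by simp
  \<comment> \<open>The bound for \<open>- x\<close> is the difference case applied to
    \<open>0 - x\<close>, which requires 0 to be an integer in this base.\<close>
  have "(nb_T tribonacci ^^ n) 0 = 0" for n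
    using nb_T_funpow_zero_mono[OF gt1, of 0 0 n] by simp
  then have "0 \<in> nb_integers tribonacci"
    using nb_digits_eq_0[OF gt1] by (auto simp: nb_integers_def nb_frac_def)
  then show ?thesis
    using nb_fr_add_diff_le[OF assms] nb_fr_add_diff_le(2)[of 0 x] assms(1) by simp
qed

end
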